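(* Let $R$ be a unital ring and let $M$ be a left $R$-module. If $M$ is Krull-Schmidt artinian, then all direct sum decompositions of $M$ refine into finite indecomposable direct sum decompositions of $M$.
   Context: A module $M$ is called Krull-Schmidt artinian if the set $\mathcal{S}(M)$ of all direct summands of $M$, partially ordered by inclusion, satisfies the descending chain condition (equivalently, the ascending chain condition). A direct sum decomposition of $M$ is an internal decomposition $M=\bigoplus_{\alpha\in A}M_\alpha$ with all $M_\alpha$ nonzero; it is indecomposable if every $M_\alpha$ is indecomposable, and finite if $A$ is finite (the zero module has the empty decomposition). A direct sum decomposition $M=\bigoplus_{\alpha\in A}M_\alpha$ refines into $M=\bigoplus_{\beta\in B}N_\beta$ if for each $\alpha\in A$ there is a direct sum decomposition $M_\alpha=\bigoplus_{\gamma_\alpha\in C_\alpha}M_{\gamma_\alpha}$ such that the decompositions $M=\bigoplus_{\alpha\in A}\bigl(\bigoplus_{\gamma_\alpha\in C_\alpha}M_{\gamma_\alpha}\bigr)$ and $M=\bigoplus_{\beta\in B}N_\beta$ are equal. *)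

theory Defs
  imports "HOL-Algebra.Algebra"
begin

text \<open>
  The axioms are those of the locale \<^locale>\<open>module\<close>, which requires a commutative ring of
  scalars; here the scalars form an arbitrary unital ring.
\<close>

locale left_module = R?: ring R + M?: abelian_group M
    for R :: "('r, 'c) ring_scheme" and M :: "('r, 'm, 'd) module_scheme" +
  assumes smult_closed:
      "\<lbrakk> a \<in> carrier R; x \<in> carrier M \<rbrakk> \<Longrightarrow> a \<odot>\<^bsub>M\<^esub> x \<in> carrier M"
    and smult_l_distr:
      "\<lbrakk> a \<in> carrier R; b \<in> carrier R; x \<in> carrier M \<rbrakk> \<Longrightarrow>
        (a \<oplus>\<^bsub>R\<^esub> b) \<odot>\<^bsub>M\<^esub> x = a \<odot>\<^bsub>M\<^esub> x \<oplus>\<^bsub>M\<^esub> b \<odot>\<^bsub>M\<^esub> x"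
    and smult_r_distr:
      "\<lbrakk> a \<in> carrier R; x \<in> carrier M; y \<in> carrier M \<rbrakk> \<Longrightarrow>
        a \<odot>\<^bsub>M\<^esub> (x \<oplus>\<^bsub>M\<^esub> y) = a \<odot>\<^bsub>M\<^esub> x \<oplus>\<^bsub>M\<^esub> a \<odot>\<^bsub>M\<^esub> y"
    and smult_assoc1:
      "\<lbrakk> a \<in> carrier R; b \<in> carrier R; x \<in> carrier M \<rbrakk> \<Longrightarrow>
        (a \<otimes>\<^bsub>R\<^esub> b) \<odot>\<^bsub>M\<^esub> x = a \<odot>\<^bsub>M\<^esub> (b \<odot>\<^bsub>M\<^esub> x)"
    and smult_one:
      "x \<in> carrier M \<Longrightarrow> \<one>\<^bsub>R\<^esub> \<odot>\<^bsub>M\<^esub> x = x"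

definition internal_direct_sum2 ::
    "('r, 'c) ring_scheme \<Rightarrow> ('r, 'm, 'd) module_scheme \<Rightarrow> 'm set \<Rightarrow> 'm set \<Rightarrow> bool"
  where "internal_direct_sum2 R M K L \<longleftrightarrow>
    submodule K R M \<and> submodule L R M \<and>
    K <+>\<^bsub>M\<^esub> L = carrier M \<and> K \<inter> L = {\<zero>\<^bsub>M\<^esub>}"

definition direct_summands ::
    "('r, 'c) ring_scheme \<Rightarrow> ('r, 'm, 'd) module_scheme \<Rightarrow> 'm set set"
  where "direct_summands R M = {K. \<exists>L. internal_direct_sum2 R M K L}"

definition krull_schmidt_artinian ::
    "('r, 'c) ring_scheme \<Rightarrow> ('r, 'm, 'd) module_scheme \<Rightarrow> bool"
  where "krull_schmidt_artinian R M \<longleftrightarrow>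
    (\<forall>S :: nat \<Rightarrow> 'm set.
       (\<forall>n. S n \<in> direct_summands R M) \<and> (\<forall>n. S (Suc n) \<subseteq> S n) \<longrightarrow>
       (\<exists>n. \<forall>m\<ge>n. S m = S n))"

definition indecomposable_module ::
    "('r, 'c) ring_scheme \<Rightarrow> ('r, 'm, 'd) module_scheme \<Rightarrow> bool"
  where "indecomposable_module R M \<longleftrightarrow>
    carrier M \<noteq> {\<zero>\<^bsub>M\<^esub>} \<and>
    (\<forall>K L. internal_direct_sum2 R M K L \<longrightarrow> K = {\<zero>\<^bsub>M\<^esub>} \<or> L = {\<zero>\<^bsub>M\<^esub>})"

text \<open>
  The family \<open>N\<close> of nonzero submodules, indexed by \<open>A\<close>, is an internal direct sum decomposition:
  every element is in a unique way a sum of a finitely supported choice of components.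
  The empty family decomposes exactly the zero module.
\<close>

definition direct_sum_decomposition ::
    "('r, 'c) ring_scheme \<Rightarrow> ('r, 'm, 'd) module_scheme \<Rightarrow> 'i set \<Rightarrow> ('i \<Rightarrow> 'm set) \<Rightarrow> bool"
  where "direct_sum_decomposition R M A N \<longleftrightarrow>
    (\<forall>\<alpha>\<in>A. submodule (N \<alpha>) R M \<and> N \<alpha> \<noteq> {\<zero>\<^bsub>M\<^esub>}) \<and>
    (\<forall>x\<in>carrier M. \<exists>!f. f \<in> (\<Pi>\<^sub>E \<alpha>\<in>A. N \<alpha>) \<and>
       finite {\<alpha>\<in>A. f \<alpha> \<noteq> \<zero>\<^bsub>M\<^esub>} \<and>
       x = (\<Oplus>\<^bsub>M\<^esub>\<alpha>\<in>{\<alpha>\<in>A. f \<alpha> \<noteq> \<zero>\<^bsub>M\<^esub>}. f \<alpha>))"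

definition indecomposable_decomposition ::
    "('r, 'c) ring_scheme \<Rightarrow> ('r, 'm, 'd) module_scheme \<Rightarrow> 'i set \<Rightarrow> ('i \<Rightarrow> 'm set) \<Rightarrow> bool"
  where "indecomposable_decomposition R M A N \<longleftrightarrow>
    direct_sum_decomposition R M A N \<and>
    (\<forall>\<alpha>\<in>A. indecomposable_module R (M\<lparr>carrier := N \<alpha>\<rparr>))"

text \<open>
  Decompositions are equal if they consist of the same summands, that is, if the families agree up
  to a bijection of their index sets. Taking the index sets \<open>C \<alpha>\<close> in the index type of the finer
  decomposition is no restriction, since each \<open>C \<alpha>\<close> injects into \<open>B\<close>.
\<close>

definition refines_into ::
    "('r, 'c) ring_scheme \<Rightarrow> ('r, 'm, 'd) module_scheme \<Rightarrow>
      'i set \<Rightarrow> ('i \<Rightarrow> 'm set) \<Rightarrow> 'j set \<Rightarrow> ('j \<Rightarrow> 'm set) \<Rightarrow> bool"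
  where "refines_into R M A N B P \<longleftrightarrow>
    direct_sum_decomposition R M A N \<and> direct_sum_decomposition R M B P \<and>
    (\<exists>(C :: 'i \<Rightarrow> 'j set) (Q :: 'i \<Rightarrow> 'j \<Rightarrow> 'm set).
       (\<forall>\<alpha>\<in>A. direct_sum_decomposition R (M\<lparr>carrier := N \<alpha>\<rparr>) (C \<alpha>) (Q \<alpha>)) \<and>
       (\<exists>\<sigma>. bij_betw \<sigma> (SIGMA \<alpha>:A. C \<alpha>) B \<and>
          (\<forall>\<alpha>\<in>A. \<forall>\<gamma>\<in>C \<alpha>. P (\<sigma> (\<alpha>, \<gamma>)) = Q \<alpha> \<gamma>)))"

end

theory Submission
  imports Defs
begin

text \<open>
  Both finiteness claims come from the descending chain condition on direct summands, and
  everything else is bookkeeping with internal direct sums.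

  The index set \<open>A\<close> is finite: from infinitely many distinct indices \<open>a 0, a 1, \<dots>\<close> one
  obtains the direct summands \<open>\<Oplus>\<alpha> \<in> A - {a 0, \<dots>, a (n - 1)}. N \<alpha>\<close>, and they shrink strictly with
  \<open>n\<close>, because the step from \<open>n\<close> to \<open>n + 1\<close> discards the nonzero module \<open>N (a n)\<close>
  (\<open>artinian_decomposition_finite\<close>).

  Every direct summand \<open>K\<close> of \<open>M\<close> is a finite direct sum of indecomposable modules. The chain
  condition makes strict inclusion of direct summands well-founded, so induction applies: if \<open>K\<close> is
  neither zero nor indecomposable, then \<open>K = K1 \<oplus> K2\<close> with both parts nonzero, hence both strictly
  smaller than \<open>K\<close>; and both are again summands of \<open>M\<close>, because a summand of a summand is a summand
  (\<open>artinian_direct_summand_finite_indecomposable\<close>).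

  In particular each of the finitely many summands \<open>N \<alpha>\<close> is such a sum. Substituting these sums into
  the given decomposition and numbering the finitely many pieces by natural numbers yields the
  refinement (\<open>finite_common_refinement\<close>).
\<close>

section \<open>Families of submodules and their sums\<close>

definition submodule_sum :: "('r, 'm, 'd) module_scheme \<Rightarrow> ('i \<Rightarrow> 'm set) \<Rightarrow> 'i set \<Rightarrow> 'm set"
  where "submodule_sum M N T =
    {(\<Oplus>\<^bsub>M\<^esub>\<alpha>\<in>F. f \<alpha>) | F f. finite F \<and> F \<subseteq> T \<and> f \<in> Pi F N}"

definition independent_family :: "('r, 'm, 'd) module_scheme \<Rightarrow> 'i set \<Rightarrow> ('i \<Rightarrow> 'm set) \<Rightarrow> bool"
  where "independent_family M A N \<longleftrightarrow>
    (\<forall>F f. finite F \<and> F \<subseteq> A \<and> f \<in> Pi F N \<and> (\<Oplus>\<^bsub>M\<^esub>\<alpha>\<in>F. f \<alpha>) = \<zero>\<^bsub>M\<^esub>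
      \<longrightarrow> (\<forall>\<alpha>\<in>F. f \<alpha> = \<zero>\<^bsub>M\<^esub>))"

text \<open>
  The internal direct sum of a family, formed inside the ambient module \<open>M\<close> and with value an
  arbitrary submodule \<open>K\<close>. Naming \<open>K\<close> keeps all iterated decompositions inside the one module \<open>M\<close>
  instead of in modules with restricted carriers. Zero members are admitted, so that splittings
  with a trivial complement are families of the same shape as all others.
\<close>

definition is_direct_sum ::
    "('r, 'c) ring_scheme \<Rightarrow> ('r, 'm, 'd) module_scheme \<Rightarrow> 'i set \<Rightarrow> ('i \<Rightarrow> 'm set) \<Rightarrow> 'm set \<Rightarrow> bool"
  where "is_direct_sum R M A N K \<longleftrightarrow>
    (\<forall>\<alpha>\<in>A. submodule (N \<alpha>) R M) \<and> submodule_sum M N A = K \<and> independent_family M A N"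

lemma submodule_sumI:
  "\<lbrakk>finite F; F \<subseteq> T; f \<in> Pi F N; x = (\<Oplus>\<^bsub>M\<^esub>\<alpha>\<in>F. f \<alpha>)\<rbrakk> \<Longrightarrow> x \<in> submodule_sum M N T"
  unfolding submodule_sum_def by blast

lemma submodule_sumE:
  assumes "x \<in> submodule_sum M N T"
  obtains F f where "finite F" "F \<subseteq> T" "f \<in> Pi F N" "x = (\<Oplus>\<^bsub>M\<^esub>\<alpha>\<in>F. f \<alpha>)"
  using assms unfolding submodule_sum_def by blast

lemma independent_familyD:
  "\<lbrakk>independent_family M A N; finite F; F \<subseteq> A; f \<in> Pi F N; (\<Oplus>\<^bsub>M\<^esub>\<alpha>\<in>F. f \<alpha>) = \<zero>\<^bsub>M\<^esub>; \<alpha> \<in> F\<rbrakk>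
    \<Longrightarrow> f \<alpha> = \<zero>\<^bsub>M\<^esub>"
  unfolding independent_family_def by blast

lemma submodule_sum_mono: "T \<subseteq> U \<Longrightarrow> submodule_sum M N T \<subseteq> submodule_sum M N U"
  unfolding submodule_sum_def by blast

context left_module
begin

section \<open>Submodules and finite sums over a noncommutative ring\<close>

text \<open>
  The locale \<^locale>\<open>module\<close> assumes commuting scalars, so the elementary facts about its
  submodules are established here for \<^locale>\<open>left_module\<close>.
\<close>

lemma smult_zero:
  assumes "a \<in> carrier R" shows "a \<odot>\<^bsub>M\<^esub> \<zero>\<^bsub>M\<^esub> = \<zero>\<^bsub>M\<^esub>"
proof -
  have "a \<odot>\<^bsub>M\<^esub> \<zero>\<^bsub>M\<^esub> \<oplus>\<^bsub>M\<^esub> a \<odot>\<^bsub>M\<^esub> \<zero>\<^bsub>M\<^esub> = a \<odot>\<^bsub>M\<^esub> \<zero>\<^bsub>M\<^esub> \<oplus>\<^bsub>M\<^esub> \<zero>\<^bsub>M\<^esub>"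
    using smult_r_distr[OF assms, of "\<zero>\<^bsub>M\<^esub>" "\<zero>\<^bsub>M\<^esub>"] smult_closed[OF assms, of "\<zero>\<^bsub>M\<^esub>"] by simp
  then show ?thesis
    using smult_closed[OF assms, of "\<zero>\<^bsub>M\<^esub>"] M.add.l_cancel M.zero_closed by blast
qed

lemma left_submoduleI:
  assumes "H \<subseteq> carrier M" "\<zero>\<^bsub>M\<^esub> \<in> H" "\<And>x. x \<in> H \<Longrightarrow> \<ominus>\<^bsub>M\<^esub> x \<in> H"
    "\<And>x y. \<lbrakk>x \<in> H; y \<in> H\<rbrakk> \<Longrightarrow> x \<oplus>\<^bsub>M\<^esub> y \<in> H"
    "\<And>a x. \<lbrakk>a \<in> carrier R; x \<in> H\<rbrakk> \<Longrightarrow> a \<odot>\<^bsub>M\<^esub> x \<in> H"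
  shows "submodule H R M"
  using assms
  by (intro submodule.intro subgroup.intro) (simp_all add: submodule_axioms_def a_inv_def)

lemma submoduleD:
  assumes "submodule H R M"
  shows "H \<subseteq> carrier M" "\<zero>\<^bsub>M\<^esub> \<in> H" "\<And>x. x \<in> H \<Longrightarrow> \<ominus>\<^bsub>M\<^esub> x \<in> H"
    "\<And>x y. \<lbrakk>x \<in> H; y \<in> H\<rbrakk> \<Longrightarrow> x \<oplus>\<^bsub>M\<^esub> y \<in> H"
    "\<And>a x. \<lbrakk>a \<in> carrier R; x \<in> H\<rbrakk> \<Longrightarrow> a \<odot>\<^bsub>M\<^esub> x \<in> H"
proof -
  interpret H: submodule H R M by fact
  show "H \<subseteq> carrier M" "\<zero>\<^bsub>M\<^esub> \<in> H"
    "\<And>x y. \<lbrakk>x \<in> H; y \<in> H\<rbrakk> \<Longrightarrow> x \<oplus>\<^bsub>M\<^esub> y \<in> H"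
    "\<And>a x. \<lbrakk>a \<in> carrier R; x \<in> H\<rbrakk> \<Longrightarrow> a \<odot>\<^bsub>M\<^esub> x \<in> H"
    using H.subset H.one_closed H.m_closed by auto
  show "\<And>x. x \<in> H \<Longrightarrow> \<ominus>\<^bsub>M\<^esub> x \<in> H"
    using H.m_inv_closed by (simp add: a_inv_def)
qed

lemma submodule_zero: "submodule {\<zero>\<^bsub>M\<^esub>} R M"
  by (rule left_submoduleI) (auto simp: smult_zero)

lemma submodule_carrier: "submodule (carrier M) R M"
  by (rule left_submoduleI) (auto simp: smult_closed)

lemma submodule_is_left_module:
  assumes K: "submodule K R M"
  shows "left_module R (M\<lparr>carrier := K\<rparr>)"
proof -
  have sub: "subgroup K (add_monoid M)" using K by (rule submodule.axioms)
  have "group (add_monoid (M\<lparr>carrier := K\<rparr>))"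
    using subgroup.subgroup_is_group[OF sub M.add.is_group] by simp
  moreover have "comm_monoid (add_monoid (M\<lparr>carrier := K\<rparr>))"
    using M.add.submonoid_is_comm_monoid[OF subgroup.subgroup_is_submonoid[OF sub]] by simp
  ultimately have "abelian_group (M\<lparr>carrier := K\<rparr>)"
    by (intro abelian_group.intro abelian_monoid.intro abelian_group_axioms.intro comm_group.intro)
  moreover have "ring R" by unfold_locales
  moreover have "left_module_axioms R (M\<lparr>carrier := K\<rparr>)"
    unfolding left_module_axioms_def
    using submoduleD[OF K] smult_l_distr smult_r_distr smult_assoc1 smult_one
    by (auto simp: subset_iff)
  ultimately show ?thesis by (intro left_module.intro)
qed

lemma minus_restrict:
  assumes K: "submodule K R M" and "x \<in> K"
  shows "\<ominus>\<^bsub>M\<lparr>carrier := K\<rparr>\<^esub> x = \<ominus>\<^bsub>M\<^esub> x"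
  using M.add.m_inv_consistent[OF submodule.axioms(1)[OF K] assms(2)] by (simp add: a_inv_def)

text \<open>
  Together with \<open>finsum_restrict\<close> below, this reduces statements about the module carried by \<open>K\<close> to
  statements about submodules of \<open>M\<close>. Inverses need an argument, since the inverse operation of a
  ring record is determined by its carrier.
\<close>

lemma submodule_restrict_iff:
  assumes K: "submodule K R M"
  shows "submodule L R (M\<lparr>carrier := K\<rparr>) \<longleftrightarrow> submodule L R M \<and> L \<subseteq> K"
proof -
  interpret K: left_module R "M\<lparr>carrier := K\<rparr>" by (rule submodule_is_left_module[OF K])
  show ?thesis
  proof
    assume L: "submodule L R (M\<lparr>carrier := K\<rparr>)"
    note p = K.submoduleD[OF L]
    have LK: "L \<subseteq> K" using p(1) by simp
    moreover have "submodule L R M"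
    proof (rule left_submoduleI)
      show "L \<subseteq> carrier M" using LK submoduleD(1)[OF K] by blast
      show "\<ominus>\<^bsub>M\<^esub> x \<in> L" if "x \<in> L" for x
        using p(3)[OF that] minus_restrict[OF K, of x] that LK by auto
    qed (use p in auto)
    ultimately show "submodule L R M \<and> L \<subseteq> K" by blast
  next
    assume L: "submodule L R M \<and> L \<subseteq> K"
    note p = submoduleD[OF conjunct1[OF L]]
    show "submodule L R (M\<lparr>carrier := K\<rparr>)"
    proof (rule K.left_submoduleI)
      show "\<ominus>\<^bsub>M\<lparr>carrier := K\<rparr>\<^esub> x \<in> L" if "x \<in> L" for x
        using p(3)[OF that] minus_restrict[OF K, of x] that L by auto
    qed (use p L in auto)
  qed
qed

lemma finsum_mem:
  assumes K: "submodule K R M" and "f \<in> F \<rightarrow> K"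
  shows "(\<Oplus>\<^bsub>M\<^esub>\<alpha>\<in>F. f \<alpha>) \<in> K"
  using assms(2)
proof (induction F rule: infinite_finite_induct)
  case (insert a F)
  then have "f \<in> F \<rightarrow> carrier M" "f a \<in> carrier M" using submoduleD(1)[OF K] by auto
  then show ?case using insert submoduleD(4)[OF K] by (simp add: Pi_iff)
qed (use submoduleD(2)[OF K] in simp_all)

text \<open>
  Not definitional: finite sums are folds relative to the carrier. The two folds satisfy the same
  recursion as long as all terms lie in \<open>K\<close>.
\<close>

lemma finsum_restrict:
  assumes K: "submodule K R M" and "finite F" "f \<in> F \<rightarrow> K"
  shows "(\<Oplus>\<^bsub>M\<lparr>carrier := K\<rparr>\<^esub>\<alpha>\<in>F. f \<alpha>) = (\<Oplus>\<^bsub>M\<^esub>\<alpha>\<in>F. f \<alpha>)"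
proof -
  interpret K: left_module R "M\<lparr>carrier := K\<rparr>" by (rule submodule_is_left_module[OF K])
  from assms(2,3) show ?thesis
  proof (induction F)
    case (insert a F)
    then have "f \<in> F \<rightarrow> carrier M" "f a \<in> carrier M" using submoduleD(1)[OF K] by auto
    then show ?case using insert by (simp add: Pi_iff)
  qed simp
qed

lemma finsum_smult:
  assumes "finite F" "a \<in> carrier R" "f \<in> F \<rightarrow> carrier M"
  shows "a \<odot>\<^bsub>M\<^esub> (\<Oplus>\<^bsub>M\<^esub>\<alpha>\<in>F. f \<alpha>) = (\<Oplus>\<^bsub>M\<^esub>\<alpha>\<in>F. a \<odot>\<^bsub>M\<^esub> f \<alpha>)"
  using assms
proof (induction F)
  case (insert x F)
  then show ?case by (simp add: Pi_iff smult_r_distr smult_closed)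
qed (simp add: smult_zero)

lemma finsum_minus:
  assumes "finite F" "f \<in> F \<rightarrow> carrier M"
  shows "\<ominus>\<^bsub>M\<^esub> (\<Oplus>\<^bsub>M\<^esub>\<alpha>\<in>F. f \<alpha>) = (\<Oplus>\<^bsub>M\<^esub>\<alpha>\<in>F. \<ominus>\<^bsub>M\<^esub> f \<alpha>)"
  using assms
proof (induction F)
  case (insert x F)
  then show ?case by (simp add: Pi_iff M.minus_add)
qed simp

lemma finsum_Sigma:
  assumes "finite F" "\<And>\<alpha>. \<alpha> \<in> F \<Longrightarrow> finite (G \<alpha>)" "h \<in> Sigma F G \<rightarrow> carrier M"
  shows "(\<Oplus>\<^bsub>M\<^esub>p\<in>Sigma F G. h p) = (\<Oplus>\<^bsub>M\<^esub>\<alpha>\<in>F. \<Oplus>\<^bsub>M\<^esub>\<gamma>\<in>G \<alpha>. h (\<alpha>, \<gamma>))"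
  using assms
proof (induction F)
  case (insert a F)
  have eq: "Sigma (insert a F) G = Pair a ` G a \<union> Sigma F G" by auto
  have "(\<Oplus>\<^bsub>M\<^esub>p\<in>Sigma (insert a F) G. h p)
      = (\<Oplus>\<^bsub>M\<^esub>p\<in>Pair a ` G a. h p) \<oplus>\<^bsub>M\<^esub> (\<Oplus>\<^bsub>M\<^esub>p\<in>Sigma F G. h p)"
    unfolding eq using insert by (intro M.finsum_Un_disjoint) (auto simp: Pi_iff)
  also have "(\<Oplus>\<^bsub>M\<^esub>p\<in>Pair a ` G a. h p) = (\<Oplus>\<^bsub>M\<^esub>\<gamma>\<in>G a. h (a, \<gamma>))"
    using insert by (intro M.finsum_reindex) (auto simp: Pi_iff inj_on_def)
  also have "(\<Oplus>\<^bsub>M\<^esub>p\<in>Sigma F G. h p) = (\<Oplus>\<^bsub>M\<^esub>\<alpha>\<in>F. \<Oplus>\<^bsub>M\<^esub>\<gamma>\<in>G \<alpha>. h (\<alpha>, \<gamma>))"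
    using insert by (auto simp: Pi_iff)
  also have "(\<Oplus>\<^bsub>M\<^esub>\<gamma>\<in>G a. h (a, \<gamma>)) \<oplus>\<^bsub>M\<^esub> \<dots>
      = (\<Oplus>\<^bsub>M\<^esub>\<alpha>\<in>insert a F. \<Oplus>\<^bsub>M\<^esub>\<gamma>\<in>G \<alpha>. h (\<alpha>, \<gamma>))"
    using insert by (subst M.finsum_insert) (auto simp: Pi_iff intro!: M.finsum_closed)
  finally show ?case .
qed simp

lemma Pi_submodules:
  assumes "\<forall>\<alpha>\<in>A. submodule (N \<alpha>) R M" "F \<subseteq> A" "f \<in> Pi F N"
  shows "f \<in> F \<rightarrow> carrier M"
  using assms submoduleD(1) by (fastforce simp: Pi_iff)

lemma finsum_extend_zero:
  assumes "finite G" "F \<subseteq> G" "f \<in> F \<rightarrow> carrier M"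
  shows "(\<Oplus>\<^bsub>M\<^esub>\<alpha>\<in>F. f \<alpha>) = (\<Oplus>\<^bsub>M\<^esub>\<alpha>\<in>G. if \<alpha> \<in> F then f \<alpha> else \<zero>\<^bsub>M\<^esub>)"
  using assms by (intro M.add.finprod_mono_neutral_cong_left) auto

section \<open>Direct sums of families\<close>

lemma submodule_sum_submodule:
  assumes N: "\<forall>\<alpha>\<in>T. submodule (N \<alpha>) R M"
  shows "submodule (submodule_sum M N T) R M"
proof (rule left_submoduleI)
  show "submodule_sum M N T \<subseteq> carrier M"
    by (auto elim!: submodule_sumE intro!: M.finsum_closed dest: Pi_submodules[OF N])
  show "\<zero>\<^bsub>M\<^esub> \<in> submodule_sum M N T"
    by (rule submodule_sumI[of "{}"]) auto
next
  fix x assume "x \<in> submodule_sum M N T"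
  then obtain F f where F: "finite F" "F \<subseteq> T" "f \<in> Pi F N" "x = (\<Oplus>\<^bsub>M\<^esub>\<alpha>\<in>F. f \<alpha>)"
    by (rule submodule_sumE)
  have f: "f \<in> F \<rightarrow> carrier M" using Pi_submodules[OF N F(2,3)] .
  show "\<ominus>\<^bsub>M\<^esub> x \<in> submodule_sum M N T"
    by (rule submodule_sumI[of F _ "\<lambda>\<alpha>. \<ominus>\<^bsub>M\<^esub> f \<alpha>"])
      (use F f N submoduleD(3) in \<open>auto simp: finsum_minus Pi_iff subset_iff\<close>)
  fix a assume "a \<in> carrier R"
  then show "a \<odot>\<^bsub>M\<^esub> x \<in> submodule_sum M N T"
    by (intro submodule_sumI[of F _ "\<lambda>\<alpha>. a \<odot>\<^bsub>M\<^esub> f \<alpha>"])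
      (use F f N submoduleD(5) in \<open>auto simp: finsum_smult Pi_iff subset_iff\<close>)
next
  fix x y assume "x \<in> submodule_sum M N T" "y \<in> submodule_sum M N T"
  then obtain F f G g where F: "finite F" "F \<subseteq> T" "f \<in> Pi F N" "x = (\<Oplus>\<^bsub>M\<^esub>\<alpha>\<in>F. f \<alpha>)"
    and G: "finite G" "G \<subseteq> T" "g \<in> Pi G N" "y = (\<Oplus>\<^bsub>M\<^esub>\<alpha>\<in>G. g \<alpha>)"
    by (auto elim!: submodule_sumE)
  \<comment> \<open>Extension by zero lets both elements be written over the same index set.\<close>
  let ?f = "\<lambda>\<alpha>. if \<alpha> \<in> F then f \<alpha> else \<zero>\<^bsub>M\<^esub>" and ?g = "\<lambda>\<alpha>. if \<alpha> \<in> G then g \<alpha> else \<zero>\<^bsub>M\<^esub>"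
  have f: "f \<in> F \<rightarrow> carrier M" "g \<in> G \<rightarrow> carrier M"
    using Pi_submodules[OF N F(2,3)] Pi_submodules[OF N G(2,3)] .
  have fg: "?f \<in> Pi (F \<union> G) N" "?g \<in> Pi (F \<union> G) N"
    using F G N submoduleD(2) by (auto simp: Pi_iff subset_iff)
  have fg': "?f \<in> F \<union> G \<rightarrow> carrier M" "?g \<in> F \<union> G \<rightarrow> carrier M"
    using f by auto
  have "x \<oplus>\<^bsub>M\<^esub> y = (\<Oplus>\<^bsub>M\<^esub>\<alpha>\<in>F \<union> G. ?f \<alpha>) \<oplus>\<^bsub>M\<^esub> (\<Oplus>\<^bsub>M\<^esub>\<alpha>\<in>F \<union> G. ?g \<alpha>)"
    using F G finsum_extend_zero[OF _ _ f(1), of "F \<union> G"] finsum_extend_zero[OF _ _ f(2), of "F \<union> G"]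
    by simp
  also have "\<dots> = (\<Oplus>\<^bsub>M\<^esub>\<alpha>\<in>F \<union> G. ?f \<alpha> \<oplus>\<^bsub>M\<^esub> ?g \<alpha>)"
    using M.finsum_addf[OF fg'] by simp
  finally have sum: "x \<oplus>\<^bsub>M\<^esub> y = (\<Oplus>\<^bsub>M\<^esub>\<alpha>\<in>F \<union> G. ?f \<alpha> \<oplus>\<^bsub>M\<^esub> ?g \<alpha>)" .
  have "(\<lambda>\<alpha>. ?f \<alpha> \<oplus>\<^bsub>M\<^esub> ?g \<alpha>) \<in> Pi (F \<union> G) N"
  proof
    fix \<alpha> assume \<alpha>: "\<alpha> \<in> F \<union> G"
    then have "submodule (N \<alpha>) R M" using N F(2) G(2) by blast
    then show "?f \<alpha> \<oplus>\<^bsub>M\<^esub> ?g \<alpha> \<in> N \<alpha>"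
      using Pi_mem[OF fg(1) \<alpha>] Pi_mem[OF fg(2) \<alpha>] by (rule submoduleD(4))
  qed
  then show "x \<oplus>\<^bsub>M\<^esub> y \<in> submodule_sum M N T"
    using F(1,2) G(1,2) sum by (intro submodule_sumI[of "F \<union> G"]) auto
qed

lemma member_subset_submodule_sum:
  assumes "submodule (N \<alpha>) R M" "\<alpha> \<in> T"
  shows "N \<alpha> \<subseteq> submodule_sum M N T"
proof
  fix x assume "x \<in> N \<alpha>"
  then show "x \<in> submodule_sum M N T"
    using assms submoduleD(1)[OF assms(1)]
    by (intro submodule_sumI[of "{\<alpha>}" _ "\<lambda>_. x"]) auto
qed

lemma submodule_sum_least:
  assumes "submodule K R M" "\<And>\<alpha>. \<alpha> \<in> T \<Longrightarrow> N \<alpha> \<subseteq> K"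
  shows "submodule_sum M N T \<subseteq> K"
  using assms by (fastforce elim!: submodule_sumE intro!: finsum_mem)

lemma submodule_sum_singleton:
  assumes "submodule (N \<alpha>) R M"
  shows "submodule_sum M N {\<alpha>} = N \<alpha>"
  using member_subset_submodule_sum[of N \<alpha> "{\<alpha>}"] submodule_sum_least[of "N \<alpha>" "{\<alpha>}" N] assms
  by auto

lemma is_direct_sum_singleton:
  assumes N: "submodule (N \<alpha>) R M"
  shows "is_direct_sum R M {\<alpha>} N (N \<alpha>)"
proof -
  have "independent_family M {\<alpha>} N"
    unfolding independent_family_def
  proof (intro allI impI ballI; elim conjE)
    fix F f \<beta>
    assume F: "F \<subseteq> {\<alpha>}" "f \<in> Pi F N" "(\<Oplus>\<^bsub>M\<^esub>\<alpha>\<in>F. f \<alpha>) = \<zero>\<^bsub>M\<^esub>" and "\<beta> \<in> F"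
    then have "F = {\<alpha>}" "\<beta> = \<alpha>" "f \<alpha> \<in> carrier M" using submoduleD(1)[OF N] by auto
    then show "f \<beta> = \<zero>\<^bsub>M\<^esub>" using F(3) by simp
  qed
  then show ?thesis using submodule_sum_singleton[of N \<alpha>, OF N] N unfolding is_direct_sum_def by simp
qed

lemma is_direct_sum_submodule: "is_direct_sum R M A N K \<Longrightarrow> submodule K R M"
  unfolding is_direct_sum_def by (blast intro: submodule_sum_submodule)

lemma is_direct_sum_restrict:
  assumes K: "submodule K R M"
  shows "is_direct_sum R (M\<lparr>carrier := K\<rparr>) A N K \<longleftrightarrow> is_direct_sum R M A N K"
proof (cases "\<forall>\<alpha>\<in>A. submodule (N \<alpha>) R M \<and> N \<alpha> \<subseteq> K")
  case True
  have fs: "(\<Oplus>\<^bsub>M\<lparr>carrier := K\<rparr>\<^esub>\<alpha>\<in>F. f \<alpha>) = (\<Oplus>\<^bsub>M\<^esub>\<alpha>\<in>F. f \<alpha>)"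
    if "finite F" "F \<subseteq> A" "f \<in> Pi F N" for F f
    using that True by (intro finsum_restrict[OF K]) fastforce+
  have "submodule_sum (M\<lparr>carrier := K\<rparr>) N A = submodule_sum M N A"
    unfolding submodule_sum_def by (intro Collect_cong iff_exI) (auto simp: fs)
  moreover have "independent_family (M\<lparr>carrier := K\<rparr>) A N \<longleftrightarrow> independent_family M A N"
    unfolding independent_family_def by (simp add: fs cong: conj_cong)
  ultimately show ?thesis
    unfolding is_direct_sum_def using submodule_restrict_iff[OF K] True by simp
next
  case False
  have "\<forall>\<alpha>\<in>A. submodule (N \<alpha>) R M \<and> N \<alpha> \<subseteq> K" if "is_direct_sum R M A N K"
    using that member_subset_submodule_sum[of N _ A] unfolding is_direct_sum_def by blast
  then show ?thesis
    using False unfolding is_direct_sum_def submodule_restrict_iff[OF K] by blast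
qed

text \<open>
  A representation of an element by a function on \<open>A\<close> with finite support is the same thing as a
  sum over some finite subset of \<open>A\<close>, extended by zero. Existence of representations thus says that the
  sum of the family is all of \<open>M\<close>; uniqueness says that the family is independent, as the difference
  of two representations of one element represents zero.
\<close>

lemma decomposition_iff_is_direct_sum:
  "direct_sum_decomposition R M A N \<longleftrightarrow>
    is_direct_sum R M A N (carrier M) \<and> (\<forall>\<alpha>\<in>A. N \<alpha> \<noteq> {\<zero>\<^bsub>M\<^esub>})"
proof (cases "\<forall>\<alpha>\<in>A. submodule (N \<alpha>) R M")
  case N: True
  let ?rep = "\<lambda>x f. f \<in> (\<Pi>\<^sub>E \<alpha>\<in>A. N \<alpha>) \<and> finite {\<alpha>\<in>A. f \<alpha> \<noteq> \<zero>\<^bsub>M\<^esub>} \<and>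
       x = (\<Oplus>\<^bsub>M\<^esub>\<alpha>\<in>{\<alpha>\<in>A. f \<alpha> \<noteq> \<zero>\<^bsub>M\<^esub>}. f \<alpha>)"
  \<comment> \<open>The representing functions are extensional, hence the restriction to \<open>A\<close>.\<close>
  let ?ext = "\<lambda>F f. restrict (\<lambda>\<alpha>. if \<alpha> \<in> F then f \<alpha> else \<zero>\<^bsub>M\<^esub>) A"
  have zero: "\<And>\<alpha>. \<alpha> \<in> A \<Longrightarrow> \<zero>\<^bsub>M\<^esub> \<in> N \<alpha>" using N submoduleD(2) by blast
  have ext: "?rep (\<Oplus>\<^bsub>M\<^esub>\<alpha>\<in>F. f \<alpha>) (?ext F f)" if F: "finite F" "F \<subseteq> A" "f \<in> Pi F N" for F f
  proof -
    have sub: "{\<alpha>\<in>A. ?ext F f \<alpha> \<noteq> \<zero>\<^bsub>M\<^esub>} \<subseteq> F" by auto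
    have "(\<Oplus>\<^bsub>M\<^esub>\<alpha>\<in>F. f \<alpha>) = (\<Oplus>\<^bsub>M\<^esub>\<alpha>\<in>{\<alpha>\<in>A. ?ext F f \<alpha> \<noteq> \<zero>\<^bsub>M\<^esub>}. ?ext F f \<alpha>)"
      using Pi_submodules[OF N F(2,3)] F(2)
      by (intro M.add.finprod_mono_neutral_cong_right[OF F(1) sub]) auto
    then show ?thesis
      using finite_subset[OF sub F(1)] F(3) zero by (auto simp: Pi_iff)
  qed
  have supp: "(\<Oplus>\<^bsub>M\<^esub>\<alpha>\<in>{\<alpha>\<in>A. f \<alpha> \<noteq> \<zero>\<^bsub>M\<^esub>}. f \<alpha>) = (\<Oplus>\<^bsub>M\<^esub>\<alpha>\<in>G. f \<alpha>)"
    if "finite G" "{\<alpha>\<in>A. f \<alpha> \<noteq> \<zero>\<^bsub>M\<^esub>} \<subseteq> G" "G \<subseteq> A" "f \<in> Pi A N" for f G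
    using that Pi_submodules[OF N subset_refl that(4)]
    by (intro M.add.finprod_mono_neutral_cong_left) auto
  have exists_iff: "(\<forall>x\<in>carrier M. \<exists>f. ?rep x f) \<longleftrightarrow> submodule_sum M N A = carrier M"
  proof
    assume ex: "\<forall>x\<in>carrier M. \<exists>f. ?rep x f"
    have "carrier M \<subseteq> submodule_sum M N A"
    proof
      fix x assume "x \<in> carrier M"
      with ex obtain f where "?rep x f" by blast
      then show "x \<in> submodule_sum M N A"
        by (intro submodule_sumI[of "{\<alpha>\<in>A. f \<alpha> \<noteq> \<zero>\<^bsub>M\<^esub>}" _ f]) auto
    qed
    then show "submodule_sum M N A = carrier M"
      using submoduleD(1)[OF submodule_sum_submodule[OF N]] by blast
  next
    assume sum: "submodule_sum M N A = carrier M"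
    show "\<forall>x\<in>carrier M. \<exists>f. ?rep x f"
    proof
      fix x assume "x \<in> carrier M"
      then obtain F f where "finite F" "F \<subseteq> A" "f \<in> Pi F N" "x = (\<Oplus>\<^bsub>M\<^esub>\<alpha>\<in>F. f \<alpha>)"
        using sum submodule_sumE[of x M N A] by blast
      then show "\<exists>f. ?rep x f" using ext by blast
    qed
  qed
  have unique_iff: "(\<forall>x\<in>carrier M. \<forall>f g. ?rep x f \<longrightarrow> ?rep x g \<longrightarrow> f = g) \<longleftrightarrow> independent_family M A N"
  proof
    assume unique: "\<forall>x\<in>carrier M. \<forall>f g. ?rep x f \<longrightarrow> ?rep x g \<longrightarrow> f = g"
    show "independent_family M A N"
      unfolding independent_family_def
    proof (intro allI impI ballI; elim conjE)
      fix F f \<alpha>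
      assume F: "finite F" "F \<subseteq> A" "f \<in> Pi F N" "(\<Oplus>\<^bsub>M\<^esub>\<alpha>\<in>F. f \<alpha>) = \<zero>\<^bsub>M\<^esub>" and "\<alpha> \<in> F"
      \<comment> \<open>Zero is represented both by \<open>f\<close> and by the zero function.\<close>
      have "?rep \<zero>\<^bsub>M\<^esub> (?ext F f)" using ext[OF F(1-3)] F(4) by simp
      moreover have "?rep \<zero>\<^bsub>M\<^esub> (?ext {} f)" using ext[of "{}" f] by simp
      ultimately have "?ext F f = ?ext {} f" using unique M.zero_closed by blast
      then have "?ext F f \<alpha> = ?ext {} f \<alpha>" by (rule fun_cong)
      then show "f \<alpha> = \<zero>\<^bsub>M\<^esub>" using \<open>\<alpha> \<in> F\<close> F(2) by auto
    qed
  next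
    assume ind: "independent_family M A N"
    show "\<forall>x\<in>carrier M. \<forall>f g. ?rep x f \<longrightarrow> ?rep x g \<longrightarrow> f = g"
    proof (intro ballI allI impI)
      fix x f g assume f: "?rep x f" and g: "?rep x g"
      let ?G = "{\<alpha>\<in>A. f \<alpha> \<noteq> \<zero>\<^bsub>M\<^esub>} \<union> {\<alpha>\<in>A. g \<alpha> \<noteq> \<zero>\<^bsub>M\<^esub>}"
      have G: "finite ?G" "?G \<subseteq> A" using f g by auto
      have fgN: "f \<in> Pi A N" "g \<in> Pi A N" using f g by auto
      have fg: "f \<in> A \<rightarrow> carrier M" "g \<in> A \<rightarrow> carrier M"
        using Pi_submodules[OF N subset_refl] fgN by auto
      have fgG: "f \<in> ?G \<rightarrow> carrier M" "g \<in> ?G \<rightarrow> carrier M" using fg by auto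
      have x: "x = (\<Oplus>\<^bsub>M\<^esub>\<alpha>\<in>?G. f \<alpha>)" "x = (\<Oplus>\<^bsub>M\<^esub>\<alpha>\<in>?G. g \<alpha>)"
        using f supp[OF G(1) _ G(2) fgN(1)] g supp[OF G(1) _ G(2) fgN(2)] by auto
      have xM: "x \<in> carrier M" unfolding x(1) using fgG(1) by (rule M.finsum_closed)
      have "(\<Oplus>\<^bsub>M\<^esub>\<alpha>\<in>?G. f \<alpha> \<oplus>\<^bsub>M\<^esub> \<ominus>\<^bsub>M\<^esub> g \<alpha>) = x \<oplus>\<^bsub>M\<^esub> \<ominus>\<^bsub>M\<^esub> x"
        using M.finsum_addf[OF fgG(1), of "\<lambda>\<alpha>. \<ominus>\<^bsub>M\<^esub> g \<alpha>"] finsum_minus[OF G(1) fgG(2)] fgG(2) x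
        by (auto simp: Pi_iff)
      then have sum: "(\<Oplus>\<^bsub>M\<^esub>\<alpha>\<in>?G. f \<alpha> \<oplus>\<^bsub>M\<^esub> \<ominus>\<^bsub>M\<^esub> g \<alpha>) = \<zero>\<^bsub>M\<^esub>"
        using xM by (simp add: M.r_neg)
      have mem: "(\<lambda>\<alpha>. f \<alpha> \<oplus>\<^bsub>M\<^esub> \<ominus>\<^bsub>M\<^esub> g \<alpha>) \<in> Pi ?G N"
        using fgN N submoduleD(3,4) by (auto simp: Pi_iff)
      show "f = g"
      proof
        fix \<alpha>
        show "f \<alpha> = g \<alpha>"
        proof (cases "\<alpha> \<in> ?G")
          case True
          have "f \<alpha> \<oplus>\<^bsub>M\<^esub> \<ominus>\<^bsub>M\<^esub> g \<alpha> = \<zero>\<^bsub>M\<^esub>"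
            using independent_familyD[OF ind G mem sum True] .
          moreover have "f \<alpha> \<in> carrier M" "g \<alpha> \<in> carrier M" using True fg by auto
          ultimately show ?thesis using M.minus_equality M.minus_minus
            by (metis M.add.inv_closed)
        next
          case False
          show ?thesis
          proof (cases "\<alpha> \<in> A")
            case True
            then have "f \<alpha> = \<zero>\<^bsub>M\<^esub>" "g \<alpha> = \<zero>\<^bsub>M\<^esub>" using False by blast+
            then show ?thesis by simp
          next
            case False
            then show ?thesis
              using PiE_arb[OF conjunct1[OF f]] PiE_arb[OF conjunct1[OF g]] by simp
          qed
        qed
      qed
    qed
  qed
  have "(\<forall>x\<in>carrier M. \<exists>!f. ?rep x f) \<longleftrightarrow>
    (\<forall>x\<in>carrier M. \<exists>f. ?rep x f) \<and> (\<forall>x\<in>carrier M. \<forall>f g. ?rep x f \<longrightarrow> ?rep x g \<longrightarrow> f = g)"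
    by blast
  then show ?thesis
    unfolding direct_sum_decomposition_def is_direct_sum_def exists_iff unique_iff using N by blast
next
  case False
  then show ?thesis unfolding direct_sum_decomposition_def is_direct_sum_def by blast
qed

lemma decomposition_restrict_iff:
  assumes K: "submodule K R M"
  shows "direct_sum_decomposition R (M\<lparr>carrier := K\<rparr>) A N \<longleftrightarrow>
    is_direct_sum R M A N K \<and> (\<forall>\<alpha>\<in>A. N \<alpha> \<noteq> {\<zero>\<^bsub>M\<^esub>})"
  using is_direct_sum_restrict[OF K, of A N]
  by (simp add: left_module.decomposition_iff_is_direct_sum[OF submodule_is_left_module[OF K]])

text \<open>
  Transitivity of direct sums. For independence, a vanishing sum over pairs is grouped by first
  components: the inner sums form a vanishing sum over the outer family, so each of them vanishes by
  independence of \<open>N\<close>, and then each of their terms by independence of \<open>Q \<alpha>\<close>.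
\<close>

lemma is_direct_sum_Sigma:
  assumes N: "is_direct_sum R M A N K"
    and Q: "\<And>\<alpha>. \<alpha> \<in> A \<Longrightarrow> is_direct_sum R M (C \<alpha>) (Q \<alpha>) (N \<alpha>)"
  shows "is_direct_sum R M (Sigma A C) (\<lambda>(\<alpha>, \<gamma>). Q \<alpha> \<gamma>) K"
proof -
  let ?Q = "\<lambda>(\<alpha>, \<gamma>). Q \<alpha> \<gamma>"
  have K: "submodule K R M" using is_direct_sum_submodule[OF N] .
  have sub: "\<forall>p\<in>Sigma A C. submodule (?Q p) R M"
    using Q unfolding is_direct_sum_def by auto
  have "submodule_sum M ?Q (Sigma A C) \<subseteq> K"
  proof (rule submodule_sum_least[OF K])
    fix p assume p: "p \<in> Sigma A C"
    obtain \<alpha> \<gamma> where "p = (\<alpha>, \<gamma>)" "\<alpha> \<in> A" "\<gamma> \<in> C \<alpha>" using p by auto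
    then have "?Q p \<subseteq> N \<alpha>"
      using Q[of \<alpha>] member_subset_submodule_sum[of "Q \<alpha>" \<gamma> "C \<alpha>"] unfolding is_direct_sum_def by auto
    also have "\<dots> \<subseteq> K"
      using N member_subset_submodule_sum[of N \<alpha> A] \<open>\<alpha> \<in> A\<close> unfolding is_direct_sum_def by auto
    finally show "?Q p \<subseteq> K" .
  qed
  moreover have "K \<subseteq> submodule_sum M ?Q (Sigma A C)"
  proof -
    have "N \<alpha> \<subseteq> submodule_sum M ?Q (Sigma A C)" if \<alpha>: "\<alpha> \<in> A" for \<alpha>
    proof -
      have "submodule_sum M (Q \<alpha>) (C \<alpha>) \<subseteq> submodule_sum M ?Q (Sigma A C)"
      proof (rule submodule_sum_least[OF submodule_sum_submodule[OF sub]])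
        fix \<gamma> assume "\<gamma> \<in> C \<alpha>"
        then show "Q \<alpha> \<gamma> \<subseteq> submodule_sum M ?Q (Sigma A C)"
          using \<alpha> sub member_subset_submodule_sum[of ?Q "(\<alpha>, \<gamma>)" "Sigma A C"] by auto
      qed
      then show ?thesis using Q[OF \<alpha>] unfolding is_direct_sum_def by simp
    qed
    then have "submodule_sum M N A \<subseteq> submodule_sum M ?Q (Sigma A C)"
      by (rule submodule_sum_least[OF submodule_sum_submodule[OF sub]])
    then show ?thesis using N unfolding is_direct_sum_def by simp
  qed
  moreover have "independent_family M (Sigma A C) ?Q"
    unfolding independent_family_def
  proof (intro allI impI ballI; elim conjE)
    fix F h p
    assume F: "finite F" "F \<subseteq> Sigma A C" "h \<in> Pi F ?Q"
      and sum: "(\<Oplus>\<^bsub>M\<^esub>p\<in>F. h p) = \<zero>\<^bsub>M\<^esub>" and p: "p \<in> F"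
    let ?E = "fst ` F" and ?G = "\<lambda>\<alpha>. {\<gamma>. (\<alpha>, \<gamma>) \<in> F}"
    let ?s = "\<lambda>\<alpha>. \<Oplus>\<^bsub>M\<^esub>\<gamma>\<in>?G \<alpha>. h (\<alpha>, \<gamma>)"
    have FS: "F = Sigma ?E ?G" by force
    have EA: "finite ?E" "?E \<subseteq> A" using F by auto
    have GC: "finite (?G \<alpha>)" "?G \<alpha> \<subseteq> C \<alpha>" for \<alpha>
      using finite_subset[of "?G \<alpha>" "snd ` F"] F by force+
    have hG: "(\<lambda>\<gamma>. h (\<alpha>, \<gamma>)) \<in> Pi (?G \<alpha>) (Q \<alpha>)" for \<alpha> using F(3) by auto
    have "(\<Oplus>\<^bsub>M\<^esub>p\<in>F. h p) = (\<Oplus>\<^bsub>M\<^esub>p\<in>Sigma ?E ?G. h p)" using FS by simp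
    also have "\<dots> = (\<Oplus>\<^bsub>M\<^esub>\<alpha>\<in>?E. ?s \<alpha>)"
      using Pi_submodules[OF sub F(2,3)] GC EA FS by (intro finsum_Sigma) auto
    finally have "(\<Oplus>\<^bsub>M\<^esub>\<alpha>\<in>?E. ?s \<alpha>) = \<zero>\<^bsub>M\<^esub>" using sum by simp
    moreover have "?s \<in> Pi ?E N"
    proof
      fix \<alpha> assume "\<alpha> \<in> ?E"
      then have "submodule_sum M (Q \<alpha>) (C \<alpha>) = N \<alpha>"
        using Q EA(2) unfolding is_direct_sum_def by blast
      then show "?s \<alpha> \<in> N \<alpha>" using submodule_sumI[OF GC hG refl] by blast
    qed
    moreover have "independent_family M A N" using N unfolding is_direct_sum_def by blast
    ultimately have s0: "?s \<alpha> = \<zero>\<^bsub>M\<^esub>" if "\<alpha> \<in> ?E" for \<alpha>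
      using independent_familyD[OF _ EA, of M N ?s] that by blast
    obtain \<alpha> \<gamma> where eq: "p = (\<alpha>, \<gamma>)" by (cases p)
    have \<alpha>: "\<alpha> \<in> ?E" using p eq by force
    then have "independent_family M (C \<alpha>) (Q \<alpha>)" using Q EA(2) unfolding is_direct_sum_def by blast
    from independent_familyD[OF this GC hG s0[OF \<alpha>], of \<gamma>] show "h p = \<zero>\<^bsub>M\<^esub>" using p eq by simp
  qed
  ultimately show ?thesis using sub unfolding is_direct_sum_def by blast
qed

lemma is_direct_sum_reindex:
  assumes N: "is_direct_sum R M A N K" and \<tau>: "bij_betw \<tau> A B"
    and P: "\<And>\<alpha>. \<alpha> \<in> A \<Longrightarrow> P (\<tau> \<alpha>) = N \<alpha>"
  shows "is_direct_sum R M B P K"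
proof -
  have inj: "inj_on \<tau> A" and B: "B = \<tau> ` A" using \<tau> by (auto simp: bij_betw_def)
  have subN: "\<forall>\<alpha>\<in>A. submodule (N \<alpha>) R M" using N unfolding is_direct_sum_def by blast
  have sub: "\<forall>\<beta>\<in>B. submodule (P \<beta>) R M"
    using subN P B by auto
  have "submodule_sum M P B \<subseteq> submodule_sum M N A"
  proof (rule submodule_sum_least[OF submodule_sum_submodule[OF subN]])
    fix \<beta> assume "\<beta> \<in> B"
    then obtain \<alpha> where "\<alpha> \<in> A" "P \<beta> = N \<alpha>" using B P by blast
    then show "P \<beta> \<subseteq> submodule_sum M N A"
      using subN member_subset_submodule_sum[of N \<alpha> A] by simp
  qed
  moreover have "submodule_sum M N A \<subseteq> submodule_sum M P B"
  proof (rule submodule_sum_least[OF submodule_sum_submodule[OF sub]])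
    fix \<alpha> assume "\<alpha> \<in> A"
    then show "N \<alpha> \<subseteq> submodule_sum M P B"
      using sub member_subset_submodule_sum[of P "\<tau> \<alpha>" B] P B by auto
  qed
  moreover have "independent_family M B P"
    unfolding independent_family_def
  proof (intro allI impI ballI; elim conjE)
    fix F f \<beta>
    assume F: "finite F" "F \<subseteq> B" "f \<in> Pi F P" and sum: "(\<Oplus>\<^bsub>M\<^esub>\<beta>\<in>F. f \<beta>) = \<zero>\<^bsub>M\<^esub>"
      and \<beta>: "\<beta> \<in> F"
    obtain E where E: "E \<subseteq> A" "F = \<tau> ` E" using F(2) B by (meson subset_imageE)
    have injE: "inj_on \<tau> E" using inj E(1) by (rule inj_on_subset)
    have "finite E" using F(1) E(2) injE finite_image_iff by blast
    moreover have "(\<Oplus>\<^bsub>M\<^esub>\<alpha>\<in>E. f (\<tau> \<alpha>)) = \<zero>\<^bsub>M\<^esub>"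
      using M.finsum_reindex[of f \<tau> E] Pi_submodules[OF sub F(2,3)] E(2) injE sum by simp
    moreover have "(\<lambda>\<alpha>. f (\<tau> \<alpha>)) \<in> Pi E N" using F(3) E P by (auto simp: Pi_iff)
    moreover have "independent_family M A N" using N unfolding is_direct_sum_def by blast
    moreover obtain \<alpha> where "\<alpha> \<in> E" "\<beta> = \<tau> \<alpha>" using \<beta> E(2) by blast
    ultimately show "f \<beta> = \<zero>\<^bsub>M\<^esub>"
      using independent_familyD[OF _ _ E(1), of M N "\<lambda>\<alpha>. f (\<tau> \<alpha>)" \<alpha>] by blast
  qed
  ultimately show ?thesis using N sub unfolding is_direct_sum_def by blast
qed

text \<open>
  Substituting finite decompositions into a finite decomposition. The pieces are renumbered by
  natural numbers, so that repeated refinement does not change the index type and can be used in an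
  induction.
\<close>

lemma finite_common_refinement:
  assumes N: "is_direct_sum R M A N K" and fin: "finite A" "\<And>\<alpha>. \<alpha> \<in> A \<Longrightarrow> finite (C \<alpha>)"
    and Q: "\<And>\<alpha>. \<alpha> \<in> A \<Longrightarrow> is_direct_sum R M (C \<alpha>) (Q \<alpha>) (N \<alpha>)"
  obtains B :: "nat set" and P \<tau> where "finite B" "bij_betw \<tau> (Sigma A C) B"
    "\<And>\<alpha> \<gamma>. \<lbrakk>\<alpha> \<in> A; \<gamma> \<in> C \<alpha>\<rbrakk> \<Longrightarrow> P (\<tau> (\<alpha>, \<gamma>)) = Q \<alpha> \<gamma>" "is_direct_sum R M B P K"
proof -
  have "finite (Sigma A C)" using fin by auto
  then obtain \<tau> where \<tau>: "bij_betw \<tau> (Sigma A C) {0..<card (Sigma A C)}"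
    using ex_bij_betw_finite_nat by blast
  define P where "P \<beta> = (case inv_into (Sigma A C) \<tau> \<beta> of (\<alpha>, \<gamma>) \<Rightarrow> Q \<alpha> \<gamma>)" for \<beta>
  have P: "P (\<tau> p) = (case p of (\<alpha>, \<gamma>) \<Rightarrow> Q \<alpha> \<gamma>)" if "p \<in> Sigma A C" for p
    unfolding P_def using bij_betw_inv_into_left[OF \<tau> that] by simp
  have "is_direct_sum R M {0..<card (Sigma A C)} P K"
    by (rule is_direct_sum_reindex[OF is_direct_sum_Sigma[OF N] \<tau>]) (use Q P in auto)
  then show thesis
    using that[OF _ \<tau>, of P] P by (auto simp: mem_Sigma_iff)
qed

section \<open>Direct summands\<close>

text \<open>
  An element of both sums gives two expressions over disjoint index sets; their difference is a
  vanishing sum over the union, so independence kills every term.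
\<close>

lemma sums_over_disjoint_inter:
  assumes ind: "independent_family M A N" and sub: "\<forall>\<alpha>\<in>A. submodule (N \<alpha>) R M"
    and T: "T \<subseteq> A" "U \<subseteq> A" "T \<inter> U = {}"
  shows "submodule_sum M N T \<inter> submodule_sum M N U = {\<zero>\<^bsub>M\<^esub>}"
proof -
  have "x = \<zero>\<^bsub>M\<^esub>" if x: "x \<in> submodule_sum M N T" "x \<in> submodule_sum M N U" for x
  proof -
    obtain F f where F: "finite F" "F \<subseteq> T" "f \<in> Pi F N" "x = (\<Oplus>\<^bsub>M\<^esub>\<alpha>\<in>F. f \<alpha>)"
      using x(1) by (rule submodule_sumE)
    obtain G g where G: "finite G" "G \<subseteq> U" "g \<in> Pi G N" "x = (\<Oplus>\<^bsub>M\<^esub>\<alpha>\<in>G. g \<alpha>)"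
      using x(2) by (rule submodule_sumE)
    have FA: "F \<subseteq> A" and GA: "G \<subseteq> A" and FG: "F \<inter> G = {}" using F G T by auto
    have f: "f \<in> F \<rightarrow> carrier M" and g: "g \<in> G \<rightarrow> carrier M"
      using Pi_submodules[OF sub FA F(3)] Pi_submodules[OF sub GA G(3)] .
    let ?h = "\<lambda>\<alpha>. if \<alpha> \<in> F then f \<alpha> else \<ominus>\<^bsub>M\<^esub> g \<alpha>"
    have xM: "x \<in> carrier M" using F(4) f M.finsum_closed by simp
    have h: "?h \<in> F \<rightarrow> carrier M" "?h \<in> G \<rightarrow> carrier M" using f g FG by (auto simp: Pi_iff)
    have "(\<Oplus>\<^bsub>M\<^esub>\<alpha>\<in>F \<union> G. ?h \<alpha>) = (\<Oplus>\<^bsub>M\<^esub>\<alpha>\<in>F. ?h \<alpha>) \<oplus>\<^bsub>M\<^esub> (\<Oplus>\<^bsub>M\<^esub>\<alpha>\<in>G. ?h \<alpha>)"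
      using F(1) G(1) FG h by (rule M.finsum_Un_disjoint)
    also have "(\<Oplus>\<^bsub>M\<^esub>\<alpha>\<in>F. ?h \<alpha>) = x"
      unfolding F(4) using f by (intro M.finsum_cong') (auto simp: Pi_iff)
    also have "(\<Oplus>\<^bsub>M\<^esub>\<alpha>\<in>G. ?h \<alpha>) = (\<Oplus>\<^bsub>M\<^esub>\<alpha>\<in>G. \<ominus>\<^bsub>M\<^esub> g \<alpha>)"
      using g FG by (intro M.finsum_cong') (auto simp: Pi_iff)
    also have "\<dots> = \<ominus>\<^bsub>M\<^esub> x" unfolding G(4) using finsum_minus[OF G(1) g] by simp
    finally have sum: "(\<Oplus>\<^bsub>M\<^esub>\<alpha>\<in>F \<union> G. ?h \<alpha>) = \<zero>\<^bsub>M\<^esub>" using xM by (simp add: M.r_neg)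
    have "?h \<in> Pi (F \<union> G) N"
      using F(3) G(3) GA sub submoduleD(3) by (auto simp: Pi_iff subset_iff)
    then have "?h \<alpha> = \<zero>\<^bsub>M\<^esub>" if "\<alpha> \<in> F" for \<alpha>
      using independent_familyD[OF ind _ _ _ sum, of \<alpha>] F(1) G(1) FA GA that by blast
    then have "f \<alpha> = \<zero>\<^bsub>M\<^esub>" if "\<alpha> \<in> F" for \<alpha> using that by fastforce
    then show ?thesis unfolding F(4) by (rule M.add.finprod_one_eqI)
  qed
  moreover have "\<zero>\<^bsub>M\<^esub> \<in> submodule_sum M N T" "\<zero>\<^bsub>M\<^esub> \<in> submodule_sum M N U"
    using sub T by (auto intro!: submoduleD(2) submodule_sum_submodule)
  ultimately show ?thesis by blast
qed

lemma internal_direct_sum2_split: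
  assumes N: "is_direct_sum R M A N (carrier M)" and T: "T \<subseteq> A"
  shows "internal_direct_sum2 R M (submodule_sum M N T) (submodule_sum M N (A - T))"
proof -
  have ind: "independent_family M A N" and sub: "\<forall>\<alpha>\<in>A. submodule (N \<alpha>) R M"
    and sum: "submodule_sum M N A = carrier M"
    using N unfolding is_direct_sum_def by blast+
  let ?K = "submodule_sum M N T" and ?L = "submodule_sum M N (A - T)"
  have K: "submodule ?K R M" and L: "submodule ?L R M"
    using sub T by (auto intro!: submodule_sum_submodule)
  have "carrier M \<subseteq> ?K <+>\<^bsub>M\<^esub> ?L"
  proof
    fix x assume "x \<in> carrier M"
    then obtain F f where F: "finite F" "F \<subseteq> A" "f \<in> Pi F N" "x = (\<Oplus>\<^bsub>M\<^esub>\<alpha>\<in>F. f \<alpha>)"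
      using sum submodule_sumE[of x M N A] by blast
    have f: "f \<in> F \<rightarrow> carrier M" using Pi_submodules[OF sub F(2,3)] .
    have "x = (\<Oplus>\<^bsub>M\<^esub>\<alpha>\<in>(F \<inter> T) \<union> (F - T). f \<alpha>)"
      unfolding F(4) by (simp add: Int_Diff_Un)
    also have "\<dots> = (\<Oplus>\<^bsub>M\<^esub>\<alpha>\<in>F \<inter> T. f \<alpha>) \<oplus>\<^bsub>M\<^esub> (\<Oplus>\<^bsub>M\<^esub>\<alpha>\<in>F - T. f \<alpha>)"
      using F(1) f by (intro M.finsum_Un_disjoint) auto
    finally have x: "x = (\<Oplus>\<^bsub>M\<^esub>\<alpha>\<in>F \<inter> T. f \<alpha>) \<oplus>\<^bsub>M\<^esub> (\<Oplus>\<^bsub>M\<^esub>\<alpha>\<in>F - T. f \<alpha>)" .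
    have "(\<Oplus>\<^bsub>M\<^esub>\<alpha>\<in>F \<inter> T. f \<alpha>) \<in> ?K"
      by (rule submodule_sumI[of "F \<inter> T" _ f]) (use F in auto)
    moreover have "(\<Oplus>\<^bsub>M\<^esub>\<alpha>\<in>F - T. f \<alpha>) \<in> ?L"
      by (rule submodule_sumI[of "F - T" _ f]) (use F in auto)
    ultimately show "x \<in> ?K <+>\<^bsub>M\<^esub> ?L" unfolding set_add_def' using x by blast
  qed
  moreover have "?K <+>\<^bsub>M\<^esub> ?L \<subseteq> carrier M"
    unfolding set_add_def' using submoduleD(1)[OF K] submoduleD(1)[OF L] by auto
  ultimately show ?thesis
    unfolding internal_direct_sum2_def using K L sums_over_disjoint_inter[OF ind sub T] by blast
qed

text \<open>
  Two-term decompositions become families indexed by truth values, which makes the results on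
  families, in particular \<open>is_direct_sum_Sigma\<close>, applicable to them.
\<close>

lemma internal_direct_sum2_family:
  assumes KL: "internal_direct_sum2 R M K L"
  shows "is_direct_sum R M UNIV (\<lambda>b. if b then K else L) (carrier M)"
proof -
  let ?N = "\<lambda>b. if b then K else L"
  have K: "submodule K R M" and L: "submodule L R M" and add: "K <+>\<^bsub>M\<^esub> L = carrier M"
    and int: "K \<inter> L = {\<zero>\<^bsub>M\<^esub>}"
    using KL unfolding internal_direct_sum2_def by blast+
  note pK = submoduleD[OF K] and pL = submoduleD[OF L]
  have sub: "\<forall>b\<in>UNIV. submodule (?N b) R M" using K L by simp
  note S = submodule_sum_submodule[OF sub]
  have KS: "K \<subseteq> submodule_sum M ?N UNIV" and LS: "L \<subseteq> submodule_sum M ?N UNIV"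
    using member_subset_submodule_sum[of ?N True UNIV] member_subset_submodule_sum[of ?N False UNIV] K L
    by auto
  have "carrier M \<subseteq> submodule_sum M ?N UNIV"
  proof
    fix x assume "x \<in> carrier M"
    then have "x \<in> (\<Union>k\<in>K. \<Union>l\<in>L. {k \<oplus>\<^bsub>M\<^esub> l})" using add unfolding set_add_def' by simp
    then obtain k l where "k \<in> K" "l \<in> L" "x = k \<oplus>\<^bsub>M\<^esub> l" by blast
    then show "x \<in> submodule_sum M ?N UNIV"
      using submoduleD(4)[OF S, of k l] subsetD[OF KS] subsetD[OF LS] by simp
  qed
  then have "submodule_sum M ?N UNIV = carrier M" using submoduleD(1)[OF S] by (rule equalityI[rotated])
  moreover have "independent_family M UNIV ?N"
    unfolding independent_family_def
  proof (intro allI impI ballI; elim conjE)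
    fix F f b
    assume F: "finite F" "f \<in> Pi F ?N" and sum: "(\<Oplus>\<^bsub>M\<^esub>b\<in>F. f b) = \<zero>\<^bsub>M\<^esub>" and b: "b \<in> F"
    \<comment> \<open>Extending by zero to both indices avoids a case distinction on \<open>F\<close>.\<close>
    define g where "g = (\<lambda>b. if b \<in> F then f b else \<zero>\<^bsub>M\<^esub>)"
    have f: "f \<in> F \<rightarrow> carrier M" using Pi_submodules[OF sub _ F(2)] by simp
    have gs: "g True \<in> K" "g False \<in> L" using F(2) pK(2) pL(2) by (auto simp: Pi_iff g_def)
    have gM: "g True \<in> carrier M" "g False \<in> carrier M" using gs pK(1) pL(1) by blast+
    have gM': "\<And>b. g b \<in> carrier M" using f by (auto simp: g_def)
    have "\<zero>\<^bsub>M\<^esub> = (\<Oplus>\<^bsub>M\<^esub>b\<in>{True, False}. g b)"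
      using finsum_extend_zero[OF _ _ f, of "{True, False}"] sum by (auto simp: UNIV_bool[symmetric] g_def)
    also have "\<dots> = g True \<oplus>\<^bsub>M\<^esub> g False"
      using gM gM' by (subst M.finsum_insert) (auto simp: Pi_iff)
    finally have "g True \<oplus>\<^bsub>M\<^esub> g False = \<zero>\<^bsub>M\<^esub>" by (rule sym)
    then have eq: "g True = \<ominus>\<^bsub>M\<^esub> g False" using M.minus_equality gM by metis
    then have "g True \<in> K \<inter> L" using gs pL(3)[OF gs(2)] by simp
    then have T: "g True = \<zero>\<^bsub>M\<^esub>" using int by blast
    then have "g False = \<zero>\<^bsub>M\<^esub>" using M.r_neg[OF gM(2)] eq[symmetric] gM(2) by simp
    then show "f b = \<zero>\<^bsub>M\<^esub>" using T b by (cases b) (auto simp: g_def)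
  qed
  ultimately show ?thesis using sub unfolding is_direct_sum_def by blast
qed

lemma internal_direct_sum2_restrict:
  assumes U: "submodule U R M" and KL: "internal_direct_sum2 R (M\<lparr>carrier := U\<rparr>) K L"
  shows "is_direct_sum R M UNIV (\<lambda>b. if b then K else L) U"
  using left_module.internal_direct_sum2_family[OF submodule_is_left_module[OF U] KL]
  by (simp add: is_direct_sum_restrict[OF U])

lemma internal_direct_sum2_zero: "internal_direct_sum2 R M (carrier M) {\<zero>\<^bsub>M\<^esub>}"
  unfolding internal_direct_sum2_def set_add_def'
  using submodule_carrier submodule_zero by force

lemma internal_direct_sum2_commute:
  assumes "internal_direct_sum2 R M K L" shows "internal_direct_sum2 R M L K"
proof -
  have K: "K \<subseteq> carrier M" and L: "L \<subseteq> carrier M"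
    using assms submoduleD(1) unfolding internal_direct_sum2_def by blast+
  have "L <+>\<^bsub>M\<^esub> K = K <+>\<^bsub>M\<^esub> L"
    unfolding set_add_def' using K L M.a_comm by (fastforce simp: subset_iff)
  then show ?thesis using assms unfolding internal_direct_sum2_def by blast
qed

lemma direct_summand_submodule: "K \<in> direct_summands R M \<Longrightarrow> submodule K R M"
  unfolding direct_summands_def internal_direct_sum2_def by blast

text \<open>
  If \<open>M = K \<oplus> K'\<close> and \<open>K = L \<oplus> L'\<close>, then \<open>L\<close> has the complement \<open>L' \<oplus> K'\<close>. To obtain it from
  \<open>is_direct_sum_Sigma\<close>, the summand \<open>K'\<close> is split trivially as \<open>K' \<oplus> 0\<close>; the resulting family of
  four submodules is then separated into \<open>L\<close> and the rest.
\<close>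

lemma direct_summand_trans:
  assumes K: "K \<in> direct_summands R M" and L: "L \<in> direct_summands R (M\<lparr>carrier := K\<rparr>)"
  shows "L \<in> direct_summands R M"
proof -
  obtain K' where K': "internal_direct_sum2 R M K K'" using K unfolding direct_summands_def by blast
  obtain L' where L': "internal_direct_sum2 R (M\<lparr>carrier := K\<rparr>) L L'"
    using L unfolding direct_summands_def by blast
  have sK: "submodule K R M" and sK': "submodule K' R M"
    using K' unfolding internal_direct_sum2_def by blast+
  define N where "N = (\<lambda>b. if b then K else K')"
  define Q where "Q = (\<lambda>b c. if b then if c then L else L' else if c then K' else {\<zero>\<^bsub>M\<^esub>})"
  have N: "is_direct_sum R M UNIV N (carrier M)"
    unfolding N_def by (rule internal_direct_sum2_family[OF K'])
  have zero: "internal_direct_sum2 R (M\<lparr>carrier := K'\<rparr>) K' {\<zero>\<^bsub>M\<^esub>}"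
    using left_module.internal_direct_sum2_zero[OF submodule_is_left_module[OF sK']] by simp
  have Q: "is_direct_sum R M UNIV (Q b) (N b)" for b
    using internal_direct_sum2_restrict[OF sK L'] internal_direct_sum2_restrict[OF sK' zero]
    by (cases b) (simp_all add: Q_def N_def)
  have QQ: "is_direct_sum R M (Sigma UNIV (\<lambda>b. UNIV)) (\<lambda>(b, c). Q b c) (carrier M)"
    by (rule is_direct_sum_Sigma[OF N Q])
  have "submodule L R M"
    using L' unfolding internal_direct_sum2_def submodule_restrict_iff[OF sK] by blast
  then have "submodule_sum M (\<lambda>(b, c). Q b c) {(True, True)} = L"
    using submodule_sum_singleton[of "\<lambda>(b, c). Q b c" "(True, True)"] by (simp add: Q_def)
  then show ?thesis
    using internal_direct_sum2_split[OF QQ, of "{(True, True)}"] unfolding direct_summands_def by auto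
qed

lemma member_is_direct_summand:
  assumes N: "is_direct_sum R M A N (carrier M)" and \<alpha>: "\<alpha> \<in> A"
  shows "N \<alpha> \<in> direct_summands R M"
proof -
  have "submodule_sum M N {\<alpha>} = N \<alpha>"
    using N \<alpha> submodule_sum_singleton[of N \<alpha>] unfolding is_direct_sum_def by blast
  then show ?thesis
    using internal_direct_sum2_split[OF N, of "{\<alpha>}"] \<alpha> unfolding direct_summands_def by auto
qed

section \<open>Consequences of the descending chain condition\<close>

text \<open>
  Removing one after another of infinitely many members produces a descending chain of summands.
  Where the chain is stationary, the member removed lies in the sum of the remaining ones; it also
  meets that sum trivially, so it would have to be zero.
\<close>

lemma artinian_decomposition_finite:
  assumes art: "krull_schmidt_artinian R M" and dec: "direct_sum_decomposition R M A N"
  shows "finite A"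
proof (rule ccontr)
  assume "infinite A"
  then obtain a :: "nat \<Rightarrow> _" where a: "inj a" "range a \<subseteq> A"
    using infinite_countable_subset by blast
  have N: "is_direct_sum R M A N (carrier M)" and nz: "\<forall>\<alpha>\<in>A. N \<alpha> \<noteq> {\<zero>\<^bsub>M\<^esub>}"
    using dec unfolding decomposition_iff_is_direct_sum by blast+
  have ind: "independent_family M A N" and sub: "\<forall>\<alpha>\<in>A. submodule (N \<alpha>) R M"
    using N unfolding is_direct_sum_def by blast+
  define S where "S n = submodule_sum M N (A - a ` {..<n})" for n
  have "S n \<in> direct_summands R M" for n
    unfolding S_def direct_summands_def using internal_direct_sum2_split[OF N] by blast
  moreover have "S (Suc n) \<subseteq> S n" for n
    unfolding S_def by (rule submodule_sum_mono) auto
  ultimately obtain n where n: "\<forall>m\<ge>n. S m = S n"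
    using art unfolding krull_schmidt_artinian_def by blast
  have an: "a n \<in> A" using a(2) by blast
  have "a n \<notin> a ` {..<n}" using a(1) by (auto simp: inj_def)
  then have "N (a n) \<subseteq> S n"
    unfolding S_def using an sub by (intro member_subset_submodule_sum) auto
  moreover have "S n = S (Suc n)" using n by (metis le_SucI order_refl)
  moreover have "submodule_sum M N {a n} \<inter> S (Suc n) = {\<zero>\<^bsub>M\<^esub>}"
    unfolding S_def by (rule sums_over_disjoint_inter[OF ind sub]) (use an in auto)
  moreover have "submodule_sum M N {a n} = N (a n)"
    using submodule_sum_singleton[of N "a n"] sub an by blast
  ultimately have "N (a n) = {\<zero>\<^bsub>M\<^esub>}" by blast
  then show False using nz an by blast
qed

lemma artinian_wf_direct_summands:
  assumes "krull_schmidt_artinian R M"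
  shows "wf {(K, L). K \<in> direct_summands R M \<and> L \<in> direct_summands R M \<and> K \<subset> L}"
  unfolding wf_iff_no_infinite_down_chain
proof
  assume "\<exists>S. \<forall>i. (S (Suc i), S i) \<in>
    {(K, L). K \<in> direct_summands R M \<and> L \<in> direct_summands R M \<and> K \<subset> L}"
  then obtain S where "\<forall>i. (S (Suc i), S i) \<in>
    {(K, L). K \<in> direct_summands R M \<and> L \<in> direct_summands R M \<and> K \<subset> L}" by blast
  then have S: "\<And>i. S i \<in> direct_summands R M" "\<And>i. S (Suc i) \<subset> S i" by auto
  then obtain n where "\<forall>m\<ge>n. S m = S n"
    using assms unfolding krull_schmidt_artinian_def by blast
  then have "S (Suc n) = S n" using le_SucI by blast
  then show False using S(2)[of n] by blast
qed

text \<open>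
  Well-founded induction on the summand: a nontrivial splitting replaces it by two strictly smaller
  summands of \<open>M\<close>, whose decompositions are put together by \<open>finite_common_refinement\<close>. The result
  carries no separate nonvanishing claim, since indecomposable modules are nonzero.
\<close>

lemma artinian_direct_summand_finite_indecomposable:
  assumes art: "krull_schmidt_artinian R M" and K: "K \<in> direct_summands R M"
  shows "\<exists>(C :: nat set) Q. finite C \<and> is_direct_sum R M C Q K \<and>
    (\<forall>\<gamma>\<in>C. indecomposable_module R (M\<lparr>carrier := Q \<gamma>\<rparr>))"
  using K
proof (induction K rule: wf_induct_rule[OF artinian_wf_direct_summands[OF art]])
  case (1 K)
  have K: "submodule K R M" using 1(2) by (rule direct_summand_submodule)
  consider "K = {\<zero>\<^bsub>M\<^esub>}" | "indecomposable_module R (M\<lparr>carrier := K\<rparr>)"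
    | "K \<noteq> {\<zero>\<^bsub>M\<^esub>}" "\<not> indecomposable_module R (M\<lparr>carrier := K\<rparr>)" by blast
  then show ?case
  proof cases
    case 1
    then have "is_direct_sum R M ({} :: nat set) (\<lambda>_. {}) K"
      unfolding is_direct_sum_def independent_family_def submodule_sum_def by auto
    then show ?thesis by blast
  next
    case 2
    have "is_direct_sum R M {0 :: nat} (\<lambda>_. K) K"
      using is_direct_sum_singleton[of "\<lambda>_. K" "0 :: nat"] K by blast
    then show ?thesis using 2 by blast
  next
    case 3
    then obtain K1 K2 where KK: "internal_direct_sum2 R (M\<lparr>carrier := K\<rparr>) K1 K2"
      and nz: "K1 \<noteq> {\<zero>\<^bsub>M\<^esub>}" "K2 \<noteq> {\<zero>\<^bsub>M\<^esub>}"
      unfolding indecomposable_module_def by auto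
    define N where "N b = (if b then K1 else K2)" for b
    have N: "is_direct_sum R M UNIV N K"
      unfolding N_def by (rule internal_direct_sum2_restrict[OF K KK])
    have "N b \<in> direct_summands R (M\<lparr>carrier := K\<rparr>)" for b
      using KK left_module.internal_direct_sum2_commute[OF submodule_is_left_module[OF K] KK]
      unfolding N_def direct_summands_def by auto
    then have ds: "N b \<in> direct_summands R M" for b
      using direct_summand_trans[OF 1(2)] by blast
    have sub: "K1 \<subseteq> K" "K2 \<subseteq> K" and int: "K1 \<inter> K2 = {\<zero>\<^bsub>M\<^esub>}"
      using KK unfolding internal_direct_sum2_def submodule_restrict_iff[OF K] by auto
    \<comment> \<open>If one part were all of \<open>K\<close>, the other would lie in the trivial intersection.\<close>
    have "N b \<subset> K" for b
      unfolding N_def using sub int nz by auto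
    then have "\<exists>(C :: nat set) Q. finite C \<and> is_direct_sum R M C Q (N b) \<and>
      (\<forall>\<gamma>\<in>C. indecomposable_module R (M\<lparr>carrier := Q \<gamma>\<rparr>))" for b
      using 1(1)[of "N b"] ds 1(2) by blast
    then obtain C :: "bool \<Rightarrow> nat set" and Q where fin: "\<And>b. finite (C b)"
      and Q: "\<And>b. is_direct_sum R M (C b) (Q b) (N b)"
      and indec: "\<And>b \<gamma>. \<gamma> \<in> C b \<Longrightarrow> indecomposable_module R (M\<lparr>carrier := Q b \<gamma>\<rparr>)"
      by metis
    obtain B :: "nat set" and P \<tau> where B: "finite B" "bij_betw \<tau> (Sigma UNIV C) B"
      "\<And>b \<gamma>. \<lbrakk>b \<in> UNIV; \<gamma> \<in> C b\<rbrakk> \<Longrightarrow> P (\<tau> (b, \<gamma>)) = Q b \<gamma>" "is_direct_sum R M B P K"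
      using finite_common_refinement[OF N _ fin Q] by (metis finite)
    have "indecomposable_module R (M\<lparr>carrier := P \<beta>\<rparr>)" if "\<beta> \<in> B" for \<beta>
      using that B(2,3) indec by (auto simp: bij_betw_def)
    then show ?thesis using B(1,4) by blast
  qed
qed

end

section \<open>Refinement into finite indecomposable decompositions\<close>

theorem proposition3p1:
  fixes R :: "('r, 'c) ring_scheme"
    and M :: "('r, 'm, 'd) module_scheme"
    and A :: "'i set"
    and N :: "'i \<Rightarrow> 'm set"
  assumes "left_module R M"
    and "krull_schmidt_artinian R M"
    and "direct_sum_decomposition R M A N"
  shows "\<exists>(B :: nat set) (P :: nat \<Rightarrow> 'm set).
    finite B \<and> indecomposable_decomposition R M B P \<and> refines_into R M A N B P"
proof -
  interpret left_module R M by fact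
  note art = assms(2) and dec = assms(3)
  have N: "is_direct_sum R M A N (carrier M)"
    using dec unfolding decomposition_iff_is_direct_sum by blast
  have finA: "finite A" using artinian_decomposition_finite[OF art dec] .
  have "\<forall>\<alpha>\<in>A. \<exists>(C :: nat set) Q. finite C \<and> is_direct_sum R M C Q (N \<alpha>) \<and>
      (\<forall>\<gamma>\<in>C. indecomposable_module R (M\<lparr>carrier := Q \<gamma>\<rparr>))"
    using artinian_direct_summand_finite_indecomposable[OF art] member_is_direct_summand[OF N] by blast
  then obtain C :: "'i \<Rightarrow> nat set" and Q where fin: "\<And>\<alpha>. \<alpha> \<in> A \<Longrightarrow> finite (C \<alpha>)"
    and Q: "\<And>\<alpha>. \<alpha> \<in> A \<Longrightarrow> is_direct_sum R M (C \<alpha>) (Q \<alpha>) (N \<alpha>)"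
    and indec: "\<And>\<alpha> \<gamma>. \<lbrakk>\<alpha> \<in> A; \<gamma> \<in> C \<alpha>\<rbrakk> \<Longrightarrow> indecomposable_module R (M\<lparr>carrier := Q \<alpha> \<gamma>\<rparr>)"
    by metis
  obtain B :: "nat set" and P \<tau> where finB: "finite B" and \<tau>: "bij_betw \<tau> (Sigma A C) B"
    and P: "\<And>\<alpha> \<gamma>. \<lbrakk>\<alpha> \<in> A; \<gamma> \<in> C \<alpha>\<rbrakk> \<Longrightarrow> P (\<tau> (\<alpha>, \<gamma>)) = Q \<alpha> \<gamma>"
    and PB: "is_direct_sum R M B P (carrier M)"
    using finite_common_refinement[OF N finA fin Q] by metis
  have indecP: "indecomposable_module R (M\<lparr>carrier := P \<beta>\<rparr>)" if "\<beta> \<in> B" for \<beta>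
    using that \<tau> P indec by (auto simp: bij_betw_def)
  have decP: "direct_sum_decomposition R M B P"
    using PB indecP unfolding decomposition_iff_is_direct_sum by (auto simp: indecomposable_module_def)
  have decQ: "direct_sum_decomposition R (M\<lparr>carrier := N \<alpha>\<rparr>) (C \<alpha>) (Q \<alpha>)" if \<alpha>: "\<alpha> \<in> A" for \<alpha>
    unfolding decomposition_restrict_iff[OF is_direct_sum_submodule[OF Q[OF \<alpha>]]]
    using Q[OF \<alpha>] indec[OF \<alpha>] by (auto simp: indecomposable_module_def)
  have "refines_into R M A N B P"
    unfolding refines_into_def using dec decP decQ \<tau> P by blast
  then show ?thesis
    unfolding indecomposable_decomposition_def using finB decP indecP by blast
qed

end
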